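(* Let $K$ be a field of characteristic zero, $a\ge2$ an integer, $F(q)=1+\sum_{n\ge1}f_nq^n\in K[[q]]$, and $L(x)=1-(1+f_1)x$. For every $r\ge0$, $$g_r(x)=\frac{H_r(x)}{L(x)^{1+\lfloor r/a\rfloor}},\qquad H_r\in K[x],$$ where $$\deg H_r\le\lfloor r/a\rfloor+\lfloor(r-1)/a\rfloor+2.$$ If $1+f_1\ne0$, the polynomial part of the rational function $g_r$ has degree at most $\lceil r/a\rceil$, and for $m\ge\lceil r/a\rceil+1$ the coefficient $[x^m]g_r$ is $(1+f_1)^m$ times a polynomial in $m$ of degree at most $\lfloor r/a\rfloor$.
   Context: Define $C_m(q)\in K[[q]]$ by $$R(X,q)=\frac{\sum_{m\ge0}X^mF(q^{am+1})}{\sum_{m\ge0}X^mF(q^{a(m+1)})}=\sum_{m\ge0}C_m(q)X^m\quad\text{in }K[[q]][[X]].$$ The diagonal generating functions are the power series $$g_r(x)=\sum_{m\ge0}[q^{am-a+1+r}]C_m(q)\,x^m\in K[[x]]\qquad(r\ge0),$$ so that $R(x/q^a,q)=\sum_{r\ge0}q^{r-a+1}g_r(x)$. Here $[q^n]$ denotes the coefficient of $q^n$ (zero for $n<0$). The polynomial part of a rational function is the polynomial quotient in the division of its numerator by its denominator. Floors of negative numbers are the usual ones ($\lfloor-1/a\rfloor=-1$). *)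

theory Defs
  imports
    "HOL-Computational_Algebra.Formal_Power_Series"
    "HOL-Computational_Algebra.Polynomial_FPS"
begin

text \<open>
  Elements of \<open>K[[q]][[X]]\<close> are represented by the type \<^typ>\<open>'a fps fps\<close>: the outer
  variable is \<open>X\<close>, the inner one is \<open>q\<close>.
\<close>

definition fps_subst_power :: "'a::field fps \<Rightarrow> nat \<Rightarrow> 'a fps" where
  "fps_subst_power F k = F oo fps_X ^ k"

definition R_num :: "nat \<Rightarrow> 'a::field fps \<Rightarrow> 'a fps fps" where
  "R_num a F = Abs_fps (\<lambda>m. fps_subst_power F (a * m + 1))"

definition R_den :: "nat \<Rightarrow> 'a::field fps \<Rightarrow> 'a fps fps" where
  "R_den a F = Abs_fps (\<lambda>m. fps_subst_power F (a * (m + 1)))"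

text \<open>
  The quotient is meaningful only if the \<open>X\<close>-constant term \<open>F(q\<^sup>a)\<close> of the denominator is a
  unit of \<open>K[[q]]\<close>; for \<open>F(0) = 1\<close> and \<open>a \<ge> 1\<close> this is lemma \<open>R_den_mult_R_fps\<close> below.
\<close>

definition R_fps :: "nat \<Rightarrow> 'a::field fps \<Rightarrow> 'a fps fps" where
  "R_fps a F = R_num a F / R_den a F"

definition C_coeff :: "nat \<Rightarrow> 'a::field fps \<Rightarrow> nat \<Rightarrow> 'a fps" where
  "C_coeff a F m = fps_nth (R_fps a F) m"

definition coeff_int :: "'a::field fps \<Rightarrow> int \<Rightarrow> 'a" where
  "coeff_int f n = (if n < 0 then 0 else fps_nth f (nat n))"

definition diag_gf :: "nat \<Rightarrow> 'a::field fps \<Rightarrow> nat \<Rightarrow> 'a fps" where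
  "diag_gf a F r =
     Abs_fps (\<lambda>m. coeff_int (C_coeff a F m) (int a * int m - int a + 1 + int r))"

definition L_poly :: "'a::field fps \<Rightarrow> 'a poly" where
  "L_poly F = [:1, - (1 + fps_nth F 1):]"

lemma R_den_mult_R_fps:
  fixes F :: "'a::field fps"
  assumes "fps_nth F 0 = 1" "a \<ge> 1"
  shows "R_den a F * R_fps a F = R_num a F"
proof -
  let ?D = "R_den a F"
  have D0: "fps_nth (fps_nth ?D 0) 0 = 1"
    using assms by (simp add: R_den_def fps_subst_power_def)
  have unit: "fps_nth ?D 0 * inverse (fps_nth ?D 0) = 1"
    using D0 by (intro inverse_mult_eq_1') simp
  have inv: "?D * inverse ?D = 1"
    using fps_right_inverse[OF unit] by (simp only: fps_inverse_def[of ?D])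
  have "fps_nth ?D 0 \<noteq> 0"
    using D0 by auto
  then have "subdegree ?D = 0"
    by (rule subdegree_eq_0)
  then have "R_fps a F = R_num a F * inverse ?D"
    by (simp add: R_fps_def fps_divide_def)
  then show ?thesis
    using inv by (metis mult.commute mult.left_commute mult_1)
qed

text \<open>
  The polynomial part of a rational function \<open>P/D\<close> is \<^term>\<open>P div D\<close>; it does not depend on
  the chosen fraction.
\<close>

lemma polynomial_part_unique:
  fixes P D P' D' :: "'a::field poly"
  assumes "D \<noteq> 0" "D' \<noteq> 0" "P * D' = P' * D"
  shows "P div D = P' div D'"
  using assms by (metis div_mult_mult1 mult.commute)

end

theory Submission
  imports Defs "HOL-Computational_Algebra.Formal_Laurent_Series"
begin

text \<open>
  Multiplying numerator and denominator of \<open>R(X,q)\<close> by \<open>(1 - X)(1 - q\<^sup>aX)\<close> replaces the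
  coefficients \<open>F(q\<^sup>a\<^sup>m\<^sup>+\<^sup>k)\<close>, for \<open>k = 1\<close> and \<open>k = a\<close>, by the second differences
  \<open>F(q\<^sup>a\<^sup>m\<^sup>+\<^sup>k) - (1 + q\<^sup>a) F(q\<^sup>a\<^sup>(\<^sup>m\<^sup>-\<^sup>1\<^sup>)\<^sup>+\<^sup>k) + q\<^sup>a F(q\<^sup>a\<^sup>(\<^sup>m\<^sup>-\<^sup>2\<^sup>)\<^sup>+\<^sup>k)\<close>. The constant and
  linear terms of \<open>F\<close> cancel there, so for \<open>m \<ge> 2\<close> these have order at least \<open>2(a(m-2) + k) + a\<close> in \<open>q\<close>.
  Hence after \<open>X = x/q\<^sup>a\<close> (and multiplication of the numerator by \<open>q\<^sup>a\<^sup>-\<^sup>1\<close>) both become power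
  series in \<open>q\<close> whose coefficients are polynomials in \<open>x\<close>: the denominator is
  \<open>L + \<Sum>\<^sub>k d\<^sub>k q\<^sup>a\<^sup>k\<close> with \<open>deg d\<^sub>k \<le> k + 1\<close>, and the coefficient of \<open>q\<^sup>s\<close> in the numerator has
  degree at most \<open>\<lceil>s/a\<rceil> + 1\<close>. Solving for the quotient \<open>\<Sum>\<^sub>r g\<^sub>r q\<^sup>r\<close> recursively gives \<open>H\<^sub>r\<close>
  and its degree; the coefficients of the proper part follow from the expansion of
  \<open>(1 - cx)\<^sup>-\<^sup>n\<close>.
\<close>

subsection \<open>Polynomials as power series of bounded degree\<close>

text \<open>Keeps the degree recursion inside the ring of power series; a polynomial is extracted
  only at the end.\<close>

definition fps_degree_le :: "nat \<Rightarrow> 'a::zero fps \<Rightarrow> bool" where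
  "fps_degree_le n f \<longleftrightarrow> (\<forall>m>n. fps_nth f m = 0)"

lemma fps_degree_le_0 [simp]: "fps_degree_le n 0"
  by (simp add: fps_degree_le_def)

lemma fps_degree_le_1 [simp]: "fps_degree_le n (1 :: 'a::{zero,one} fps)"
  by (simp add: fps_degree_le_def)

lemma fps_degree_le_diff:
  fixes f g :: "'a::ab_group_add fps"
  shows "fps_degree_le n f \<Longrightarrow> fps_degree_le n g \<Longrightarrow> fps_degree_le n (f - g)"
  by (simp add: fps_degree_le_def)

lemma fps_degree_le_sum:
  "(\<And>i. i \<in> A \<Longrightarrow> fps_degree_le n (f i)) \<Longrightarrow> fps_degree_le n (\<Sum>i\<in>A. f i)"
  by (simp add: fps_degree_le_def fps_sum_nth)

lemma fps_degree_le_mult: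
  fixes f g :: "'a::semiring_0 fps"
  assumes "fps_degree_le m f" "fps_degree_le n g"
  shows "fps_degree_le (m + n) (f * g)"
  unfolding fps_degree_le_def fps_mult_nth
proof (intro allI impI sum.neutral ballI)
  fix k i assume "k > m + n" "i \<in> {0..k}"
  then have "i > m \<or> k - i > n" by auto
  then show "fps_nth f i * fps_nth g (k - i) = 0"
    using assms by (auto simp: fps_degree_le_def)
qed

lemma fps_degree_le_power:
  fixes f :: "'a::semiring_1 fps"
  assumes "fps_degree_le 1 f"
  shows "fps_degree_le n (f ^ n)"
  by (induction n) (use fps_degree_le_mult[OF assms] in auto)

lemma fps_degree_le_imp_poly:
  fixes f :: "'a::comm_ring_1 fps"
  assumes "fps_degree_le n f"
  obtains p where "f = fps_of_poly p" "degree p \<le> n"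
proof
  let ?p = "\<Sum>i\<le>n. monom (fps_nth f i) i"
  show "degree ?p \<le> n"
    by (intro degree_sum_le) (auto intro: order_trans[OF degree_monom_le])
  show "f = fps_of_poly ?p"
    using assms by (auto simp: fps_eq_iff coeff_sum fps_degree_le_def not_le if_distrib cong: if_cong)
qed

subsection \<open>Diagonals of a product\<close>

text \<open>This is the substitution \<open>X = x/q^a\<close> with the variables exchanged:
  \<open>q\<close> is outer and \<open>x\<close> inner in the result. Terms with a negative power of
  \<open>q\<close> are dropped.\<close>

definition diagonals :: "nat \<Rightarrow> 'a::zero fps fps \<Rightarrow> 'a fps fps" where
  "diagonals a A = Abs_fps (\<lambda>r. Abs_fps (\<lambda>m. fps_nth (fps_nth A m) (a * m + r)))"

lemma diagonals_nth: "fps_nth (fps_nth (diagonals a A) r) m = fps_nth (fps_nth A m) (a * m + r)"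
  by (simp add: diagonals_def)

text \<open>
  The divisibility assumptions make the substitution of \<open>x/q\<^sup>a\<close> for \<open>X\<close> a ring homomorphism
  into \<open>K[[x]][[q]]\<close>.
\<close>

lemma diagonals_mult:
  fixes A B :: "'a::field fps fps"
  assumes A: "\<And>m. fps_X ^ (a * m) dvd fps_nth A m" and B: "\<And>m. fps_X ^ (a * m) dvd fps_nth B m"
  shows "diagonals a (A * B) = diagonals a A * diagonals a B"
proof -
  from A obtain A' where A': "\<And>m. fps_nth A m = fps_X ^ (a * m) * A' m"
    unfolding dvd_def by metis
  from B obtain B' where B': "\<And>m. fps_nth B m = fps_X ^ (a * m) * B' m"
    unfolding dvd_def by metis
  have AB: "fps_nth (A * B) m = fps_X ^ (a * m) * (\<Sum>i=0..m. A' i * B' (m - i))" for m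
  proof -
    have "A' i * B' (m - i) * fps_X ^ (a * m) = fps_nth A i * fps_nth B (m - i)"
      if "i \<le> m" for i
    proof -
      have "a * m = a * i + a * (m - i)"
        using that by (simp flip: distrib_left)
      then show ?thesis by (simp add: A' B' power_add mult_ac)
    qed
    then show ?thesis
      by (simp add: fps_mult_nth[of A] sum_distrib_left mult.commute)
  qed
  \<comment> \<open>After the forced powers of \<open>q\<close> are divided out, diagonals are
    ordinary coefficients, and the two sides are the same double Cauchy product in different
    order.\<close>
  have diag: "fps_nth (fps_nth (diagonals a A) r) m = fps_nth (A' m) r"
    "fps_nth (fps_nth (diagonals a B) r) m = fps_nth (B' m) r"
    "fps_nth (fps_nth (diagonals a (A * B)) r) m = fps_nth (\<Sum>i=0..m. A' i * B' (m - i)) r" for r m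
    by (simp_all add: diagonals_nth fps_X_power_mult_nth A' B' AB)
  show ?thesis
  proof (intro fps_ext)
    fix r m
    have "fps_nth (fps_nth (diagonals a (A * B)) r) m =
        (\<Sum>i=0..m. \<Sum>t=0..r. fps_nth (A' i) t * fps_nth (B' (m - i)) (r - t))"
      by (simp add: diag fps_sum_nth fps_mult_nth)
    also have "\<dots> = (\<Sum>t=0..r. \<Sum>i=0..m. fps_nth (A' i) t * fps_nth (B' (m - i)) (r - t))"
      by (rule sum.swap)
    also have "\<dots> = fps_nth (fps_nth (diagonals a A * diagonals a B) r) m"
      by (simp add: diag fps_sum_nth fps_mult_nth)
    finally show "fps_nth (fps_nth (diagonals a (A * B)) r) m =
        fps_nth (fps_nth (diagonals a A * diagonals a B) r) m" .
  qed
qed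

text \<open>Carries the divisibility needed by \<open>diagonals_mult\<close> over to a quotient:
  solve the Cauchy product for \<open>A_0 B_m\<close> and use that \<open>A_0\<close> is a unit of
  \<open>K[[q]]\<close>.\<close>

lemma power_dvd_quotient_nth:
  fixes A B :: "'a::field fps fps"
  assumes A: "\<And>m. fps_X ^ (a * m) dvd fps_nth A m"
    and AB: "\<And>m. fps_X ^ (a * m) dvd fps_nth (A * B) m"
    and unit: "fps_nth (fps_nth A 0) 0 \<noteq> 0"
  shows "fps_X ^ (a * m) dvd fps_nth B m"
proof (induction m rule: less_induct)
  case (less m)
  have "fps_X ^ (a * m) dvd fps_nth A i * fps_nth B (m - i)" if "i \<in> {1..m}" for i
  proof -
    have "a * m = a * i + a * (m - i)"
      using that by (simp flip: distrib_left)
    then show ?thesis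
      using mult_dvd_mono[OF A[of i] less[of "m - i"]] that by (simp add: power_add)
  qed
  then have "fps_X ^ (a * m) dvd fps_nth (A * B) m - (\<Sum>i=1..m. fps_nth A i * fps_nth B (m - i))"
    by (intro dvd_diff AB dvd_sum)
  also have "\<dots> = fps_nth A 0 * fps_nth B m"
    by (simp add: fps_mult_nth sum.atLeast_Suc_atMost)
  finally have "fps_X ^ (a * m) dvd fps_nth A 0 * fps_nth B m" .
  moreover have "fps_nth A 0 dvd 1"
    using unit by simp
  ultimately show ?case
    using dvd_mult_unit_iff' by blast
qed

subsection \<open>Clearing the denominators of numerator and denominator\<close>

text \<open>A common form for both series: \<open>k = 1\<close> gives \<open>R_num\<close> and
  \<open>k = a\<close> gives \<open>R_den\<close>.\<close>

definition progression_series :: "nat \<Rightarrow> 'a::field fps \<Rightarrow> nat \<Rightarrow> 'a fps fps" where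
  "progression_series a F k = Abs_fps (\<lambda>m. fps_subst_power F (a * m + k))"

definition cleared_series :: "nat \<Rightarrow> 'a::field fps \<Rightarrow> nat \<Rightarrow> 'a fps fps" where
  "cleared_series a F k =
     (1 - fps_X) * (1 - fps_const (fps_X ^ a) * fps_X) * progression_series a F k"

lemma cleared_series_alt:
  "cleared_series a F k = progression_series a F k
     - fps_X * (fps_const (1 + fps_X ^ a) * progression_series a F k)
     + fps_X * (fps_X * (fps_const (fps_X ^ a) * progression_series a F k))"
proof -
  have "fps_const (1 + fps_X ^ a :: 'a fps) = 1 + fps_const (fps_X ^ a)"
    by (simp flip: fps_const_add)
  then show ?thesis
    unfolding cleared_series_def by (simp only:) (simp add: algebra_simps)
qed

lemma cleared_series_nth_0: "fps_nth (cleared_series a F k) 0 = fps_subst_power F k"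
  by (simp add: cleared_series_alt progression_series_def)

lemma cleared_series_nth_1:
  "fps_nth (cleared_series a F k) (Suc 0) =
     fps_subst_power F (k + a) - (1 + fps_X ^ a) * fps_subst_power F k"
  by (simp add: cleared_series_alt progression_series_def add.commute del: fps_const_add)

lemma cleared_series_nth_Suc_Suc:
  fixes F :: "'a::field fps"
  shows "fps_nth (cleared_series a F k) (Suc (Suc m)) =
     fps_subst_power F ((a * m + k) + 2 * a)
     - (1 + fps_X ^ a) * fps_subst_power F ((a * m + k) + a)
     + fps_X ^ a * fps_subst_power F (a * m + k)"
proof -
  have idx: "a * Suc (Suc m) + k = (a * m + k) + 2 * a" "a * Suc m + k = (a * m + k) + a"
    by simp_all
  then show ?thesis
    by (simp only: cleared_series_alt progression_series_def fps_add_nth fps_sub_nth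
        fps_X_mult_nth fps_mult_left_const_nth fps_nth_Abs_fps idx nat.simps diff_Suc_1 if_False)
qed

section \<open>Orders in \<open>q\<close> of the second differences\<close>

lemma fps_subst_power_nth:
  "fps_nth (fps_subst_power F k) n = (if k dvd n then fps_nth F (n div k) else 0)"
  by (simp add: fps_subst_power_def fps_nth_compose_X_power)

text \<open>Splits off the constant and linear terms of \<open>F\<close>, which the second
  difference annihilates.\<close>

lemma fps_subst_power_expand:
  fixes F :: "'a::field fps"
  assumes "k > 0"
  shows "fps_subst_power F k = fps_const (fps_nth F 0) + fps_const (fps_nth F 1) * fps_X ^ k
    + fps_X ^ (2 * k) * fps_subst_power (fps_shift 2 F) k"
proof -
  have F: "F = fps_const (fps_nth F 0) + fps_const (fps_nth F 1) * fps_X + fps_X ^ 2 * fps_shift 2 F"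
  proof (rule fps_ext)
    fix n show "fps_nth F n = fps_nth (fps_const (fps_nth F 0) + fps_const (fps_nth F 1) * fps_X
        + fps_X ^ 2 * fps_shift 2 F) n"
      using less_2_cases[of n]
      by (auto simp: fps_X_power_mult_nth intro!: arg_cong[of _ _ "fps_nth F"])
  qed
  have X: "fps_nth (fps_X ^ k :: 'a fps) 0 = 0"
    using assms by simp
  show ?thesis
    unfolding fps_subst_power_def
    by (subst (1) F) (simp add: fps_compose_add_distrib fps_compose_mult_distrib[OF X]
        fps_X_power_compose[OF X] fps_X_fps_compose_startby0[OF X] mult.commute flip: power_mult)
qed

lemma power_dvd_second_difference:
  fixes F :: "'a::field fps"
  assumes "k > 0"
  shows "fps_X ^ (2 * k + a) dvd fps_subst_power F (k + 2 * a)
    - (1 + fps_X ^ a) * fps_subst_power F (k + a) + fps_X ^ a * fps_subst_power F k"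
    (is "_ dvd ?S")
proof -
  define T where "T = fps_subst_power (fps_shift 2 F)"
  have "?S = fps_X ^ (2 * k + a) *
      ((fps_X ^ a) ^ 3 * T (k + 2 * a) - (1 + fps_X ^ a) * fps_X ^ a * T (k + a) + T k)"
  proof -
    note exp = fps_subst_power_expand[of _ F, folded T_def]
    have powers: "(fps_X :: 'a fps) ^ (k + 2 * a) = fps_X ^ k * (fps_X ^ a)\<^sup>2"
      "(fps_X :: 'a fps) ^ (k + a) = fps_X ^ k * fps_X ^ a"
      "(fps_X :: 'a fps) ^ (2 * (k + 2 * a)) = (fps_X ^ k)\<^sup>2 * (fps_X ^ a) ^ 4"
      "(fps_X :: 'a fps) ^ (2 * (k + a)) = (fps_X ^ k)\<^sup>2 * (fps_X ^ a)\<^sup>2"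
      "(fps_X :: 'a fps) ^ (2 * k) = (fps_X ^ k)\<^sup>2"
      "(fps_X :: 'a fps) ^ (2 * k + a) = (fps_X ^ k)\<^sup>2 * fps_X ^ a"
      by (simp_all add: power_add power_mult algebra_simps flip: power_mult)
    \<comment> \<open>Here \<open>y = q^k\<close>, \<open>z = q^a\<close>, and \<open>t\<close>
      stands for the remainders. The \<open>c\<close> and \<open>f\<close> terms cancel; each
      remainder term retains a factor \<open>y^2 z\<close>.\<close>
    have "(c + f * (y * z\<^sup>2) + y\<^sup>2 * z ^ 4 * t\<^sub>2) - (1 + z) * (c + f * (y * z) + y\<^sup>2 * z\<^sup>2 * t\<^sub>1)
        + z * (c + f * y + y\<^sup>2 * t\<^sub>0) = y\<^sup>2 * z * (z ^ 3 * t\<^sub>2 - (1 + z) * z * t\<^sub>1 + t\<^sub>0)"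
      for c f y z t\<^sub>0 t\<^sub>1 t\<^sub>2 :: "'a fps"
      by algebra
    then show ?thesis
      using assms by (simp only: exp powers add_pos_nonneg zero_le)
  qed
  then show ?thesis by (rule dvdI)
qed

lemma power_dvd_cleared_series_nth:
  fixes F :: "'a::field fps"
  assumes "k > 0"
  shows "fps_X ^ (2 * (a * m + k) + a) dvd fps_nth (cleared_series a F k) (Suc (Suc m))"
  unfolding cleared_series_nth_Suc_Suc using assms by (intro power_dvd_second_difference) simp

text \<open>For \<open>m = 1\<close> the second difference lacks its third term, so only the
  constants cancel, up to a multiple of \<open>q^a\<close>. Used with \<open>n = a\<close> for the
  denominator and \<open>n = 1\<close> for the numerator.\<close>

lemma power_dvd_cleared_series_nth_1:
  fixes F :: "'a::field fps"
  assumes "k > 0" "fps_nth F 0 = 1" "n \<le> k" "n \<le> a"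
  shows "fps_X ^ n dvd fps_nth (cleared_series a F k) (Suc 0)"
proof -
  have dvd: "fps_X ^ n dvd fps_subst_power F j - 1" if "j > 0" "n \<le> j" for j
  proof -
    have "fps_subst_power F j - 1 =
      fps_X ^ j * (fps_const (fps_nth F 1) + fps_X ^ j * fps_subst_power (fps_shift 2 F) j)"
      by (simp only: fps_subst_power_expand[OF that(1), of F] assms(2) mult_2 power_add)
        (simp add: algebra_simps)
    then show ?thesis
      using le_imp_power_dvd[OF that(2), of "fps_X :: 'a fps"] by (simp add: dvd_mult2)
  qed
  have "fps_nth (cleared_series a F k) (Suc 0) =
    (fps_subst_power F (k + a) - 1) - (fps_subst_power F k - 1) - fps_X ^ a * fps_subst_power F k"
    by (simp add: cleared_series_nth_1 algebra_simps)
  also have "fps_X ^ n dvd \<dots>"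
    using assms by (intro dvd_diff dvd dvd_mult2 le_imp_power_dvd) auto
  finally show ?thesis .
qed

lemma power_dvd_imp_fps_nth_eq_0:
  fixes f :: "'a::comm_ring_1 fps"
  shows "fps_X ^ n dvd f \<Longrightarrow> i < n \<Longrightarrow> fps_nth f i = 0"
  by (auto simp: dvd_def fps_X_power_mult_nth)

lemma fps_degree_le_diagonalsI:
  assumes "\<And>m. m > n \<Longrightarrow> fps_nth (fps_nth A m) (a * m + r) = 0"
  shows "fps_degree_le n (fps_nth (diagonals a A) r)"
  using assms by (simp add: fps_degree_le_def diagonals_nth)

text \<open>The value 0 at negative indices agrees with the vanishing low coefficients after
  multiplication by \<open>q^j\<close>.\<close>

lemma coeff_int_diff: "coeff_int f (int i - int j) = fps_nth (fps_X ^ j * f) i"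
  by (auto simp: coeff_int_def fps_X_power_mult_nth nat_diff_distrib)

section \<open>Diagonals of the cleared numerator and denominator\<close>

definition cleared_den :: "nat \<Rightarrow> 'a::field fps \<Rightarrow> 'a fps fps" where
  "cleared_den a F = cleared_series a F a"

text \<open>The factor \<open>q^(a-1)\<close> absorbs the index shift \<open>1 - a\<close> of
  \<open>diag_gf\<close>; it also raises the order of the coefficient at \<open>m = 1\<close> from 1
  to \<open>a\<close>.\<close>

definition cleared_num :: "nat \<Rightarrow> 'a::field fps \<Rightarrow> 'a fps fps" where
  "cleared_num a F = fps_const (fps_X ^ (a - 1)) * cleared_series a F 1"

lemma power_dvd_cleared_num_nth:
  "fps_X ^ ((a - 1) + (2 * (a * m + 1) + a)) dvd fps_nth (cleared_num a F) (Suc (Suc m))"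
  unfolding cleared_num_def fps_mult_left_const_nth power_add[of _ "a - 1"]
  by (intro mult_dvd_mono dvd_refl power_dvd_cleared_series_nth zero_less_one)

context
  fixes F :: "'a::field fps" and a :: nat
  assumes a: "a > 0" and F0: "fps_nth F 0 = 1"
begin

lemma cleared_den_mult_R_fps:
  "cleared_den a F * (fps_const (fps_X ^ (a - 1)) * R_fps a F) = cleared_num a F"
proof -
  have "progression_series a F a = R_den a F" "progression_series a F 1 = R_num a F"
    by (simp_all add: progression_series_def R_den_def R_num_def add.commute)
  then show ?thesis
    using R_den_mult_R_fps[OF F0, of a] a
    unfolding cleared_den_def cleared_num_def cleared_series_def by (simp add: mult_ac)
qed

lemma power_dvd_cleared_den: "fps_X ^ (a * m) dvd fps_nth (cleared_den a F) m"
proof -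
  consider "m = 0" | "m = 1" | l where "m = Suc (Suc l)"
    by (metis One_nat_def not0_implies_Suc)
  then show ?thesis
  proof cases
    case 2
    then show ?thesis
      using power_dvd_cleared_series_nth_1[OF a F0, of a a] by (simp add: cleared_den_def)
  next
    case 3
    then show ?thesis
      unfolding cleared_den_def
      by (auto intro: dvd_trans[OF le_imp_power_dvd power_dvd_cleared_series_nth[OF a]])
  qed simp
qed

lemma power_dvd_cleared_num: "fps_X ^ (a * m) dvd fps_nth (cleared_num a F) m"
proof -
  consider "m = 0" | "m = 1" | l where "m = Suc (Suc l)"
    by (metis One_nat_def not0_implies_Suc)
  then show ?thesis
  proof cases
    case 2
    have "fps_X ^ (a - 1) * fps_X ^ 1 dvd fps_X ^ (a - 1) * fps_nth (cleared_series a F 1) (Suc 0)"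
      using a by (intro mult_dvd_mono power_dvd_cleared_series_nth_1 F0) auto
    also have "fps_X ^ (a - 1) * fps_X ^ 1 = (fps_X ^ a :: 'a fps)"
      using a by (simp only: power_one_right power_minus_mult)
    finally show ?thesis
      using 2 by (simp add: cleared_num_def)
  next
    case (3 l)
    have "fps_X ^ (a * m) dvd (fps_X ^ ((a - 1) + (2 * (a * l + 1) + a)) :: 'a fps)"
      using 3 a by (intro le_imp_power_dvd) simp
    also have "\<dots> dvd fps_nth (cleared_num a F) m"
      unfolding 3 by (rule power_dvd_cleared_num_nth)
    finally show ?thesis .
  qed simp
qed

text \<open>Under \<open>X = x/q^a\<close>, the series \<open>q^(a-1) R\<close> becomes the sum of
  the \<open>g_r q^r\<close>; this turns the quotient identity into a recursion for
  \<open>g_r\<close>.\<close>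

lemma diagonals_cleared_mult_diag_gf:
  "diagonals a (cleared_den a F) * Abs_fps (diag_gf a F) = diagonals a (cleared_num a F)"
proof -
  let ?Q = "fps_const (fps_X ^ (a - 1)) * R_fps a F"
  have "fps_X ^ (a * m) dvd fps_nth ?Q m" for m
    using power_dvd_cleared_den
  proof (rule power_dvd_quotient_nth)
    show "fps_X ^ (a * m) dvd fps_nth (cleared_den a F * ?Q) m" for m
      unfolding cleared_den_mult_R_fps by (rule power_dvd_cleared_num)
    show "fps_nth (fps_nth (cleared_den a F) 0) 0 \<noteq> 0"
      by (simp add: cleared_den_def cleared_series_nth_0 fps_subst_power_nth F0)
  qed
  then have "diagonals a (cleared_den a F * ?Q) = diagonals a (cleared_den a F) * diagonals a ?Q"
    by (intro diagonals_mult power_dvd_cleared_den)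
  moreover have "diagonals a ?Q = Abs_fps (diag_gf a F)"
  proof (intro fps_ext)
    fix r m
    have "int a * int m - int a + 1 + int r = int (a * m + r) - int (a - 1)"
      using a by (simp add: of_nat_diff)
    then show "fps_nth (fps_nth (diagonals a ?Q) r) m = fps_nth (fps_nth (Abs_fps (diag_gf a F)) r) m"
      by (simp only: diagonals_nth diag_gf_def C_coeff_def fps_nth_Abs_fps coeff_int_diff
        fps_mult_left_const_nth)
  qed
  ultimately show ?thesis
    by (simp only: cleared_den_mult_R_fps)
qed

lemma diagonals_cleared_den_0: "fps_nth (diagonals a (cleared_den a F)) 0 = fps_of_poly (L_poly F)"
proof (rule fps_ext)
  fix m
  consider "m = 0" | "m = 1" | l where "m = Suc (Suc l)"
    by (metis One_nat_def not0_implies_Suc)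
  then show "fps_nth (fps_nth (diagonals a (cleared_den a F)) 0) m = fps_nth (fps_of_poly (L_poly F)) m"
  proof cases
    case 1
    then show ?thesis
      by (simp add: diagonals_nth cleared_den_def cleared_series_nth_0 fps_subst_power_nth F0 L_poly_def)
  next
    case 2
    moreover have "\<not> a + a dvd a"
      using a by (auto dest: dvd_imp_le)
    \<comment> \<open>\<open>F(q^(2a))\<close> has no term in \<open>q^a\<close>, so only
      \<open>-(1 + f_1)\<close> remains.\<close>
    ultimately show ?thesis
      using a by (simp add: diagonals_nth cleared_den_def cleared_series_nth_1 fps_subst_power_nth F0
        L_poly_def distrib_right fps_X_power_mult_nth)
  next
    case (3 l)
    then show ?thesis
      using power_dvd_imp_fps_nth_eq_0[OF power_dvd_cleared_series_nth[OF a, of a l F], of "a * m"] a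
      by (simp add: diagonals_nth cleared_den_def L_poly_def)
  qed
qed

text \<open>For \<open>k = a\<close> only powers of \<open>q^a\<close> occur, and \<open>a\<close>
  divides \<open>a * m + t\<close> only if it divides \<open>t\<close>.\<close>

lemma diagonals_cleared_den_eq_0:
  assumes "\<not> a dvd t"
  shows "fps_nth (diagonals a (cleared_den a F)) t = 0"
proof (rule fps_ext)
  fix m
  have *: "fps_nth (fps_subst_power F (a * j)) s = 0" if "\<not> a dvd s" for j s
    using that by (auto simp: fps_subst_power_nth dest: dvd_mult_left)
  have "fps_nth (fps_X ^ a * fps_subst_power F (a * j)) s = 0" if "\<not> a dvd s" for j s
    using that *[of "s - a" j] by (auto simp: fps_X_power_mult_nth dvd_minus_self)
  note * = * this
  have "\<not> a dvd a * m + t"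
    using assms by (simp add: dvd_add_right_iff)
  note * = *[OF this]
  consider "m = 0" | "m = 1" | l where "m = Suc (Suc l)"
    by (metis One_nat_def not0_implies_Suc)
  then show "fps_nth (fps_nth (diagonals a (cleared_den a F)) t) m = fps_nth 0 m"
  proof cases
    case 1
    then show ?thesis
      using *(1)[of 1] by (simp add: diagonals_nth cleared_den_def cleared_series_nth_0)
  next
    case 2
    then show ?thesis
      using *(1)[of 1] *(1)[of 2] *(2)[of 1]
      by (simp add: diagonals_nth cleared_den_def cleared_series_nth_1 distrib_right mult_2_right)
  next
    case (3 l)
    have "a * l + a + 2 * a = a * (l + 3)" "a * l + a + a = a * (l + 2)" "a * l + a = a * (l + 1)"
      by (simp_all add: algebra_simps)
    then show ?thesis
      using 3 *(1)[of "l + 3"] *(1)[of "l + 2"] *(2)[of "l + 2"] *(2)[of "l + 1"]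
      by (simp only: diagonals_nth cleared_den_def cleared_series_nth_Suc_Suc distrib_right
        fps_add_nth fps_sub_nth mult_1) simp
  qed
qed

lemma fps_degree_le_diagonals_cleared_den:
  "fps_degree_le (k + 1) (fps_nth (diagonals a (cleared_den a F)) (a * k))"
proof (rule fps_degree_le_diagonalsI)
  fix m assume "m > k + 1"
  then obtain l where l: "m = Suc (Suc l)" "l \<ge> k"
    by (metis Suc_eq_plus1 Suc_le_D Suc_le_eq Suc_le_mono)
  \<comment> \<open>Applied with \<open>x = a * l\<close> and \<open>y = a * k\<close>: the index on
    the left lies below the order on the right.\<close>
  have "x + 2 * a + y < 2 * (x + a) + a" if "y \<le> x" for x y
    using that a by simp
  moreover have "a * m = a * l + 2 * a"
    by (simp add: l(1))
  ultimately have "a * m + a * k < 2 * (a * l + a) + a"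
    using mult_le_mono2[OF l(2)] by metis
  then show "fps_nth (fps_nth (cleared_den a F) m) (a * m + a * k) = 0"
    unfolding cleared_den_def l(1)
    by (rule power_dvd_imp_fps_nth_eq_0[OF power_dvd_cleared_series_nth[OF a]])
qed

lemma fps_degree_le_diagonals_cleared_num:
  "fps_degree_le ((s + a - 1) div a + 1) (fps_nth (diagonals a (cleared_num a F)) s)"
proof (rule fps_degree_le_diagonalsI)
  fix m assume m: "m > (s + a - 1) div a + 1"
  then obtain l where l: "m = Suc (Suc l)" "l \<ge> (s + a - 1) div a"
    by (metis Suc_eq_plus1 Suc_le_D Suc_le_eq Suc_le_mono)
  \<comment> \<open>Equivalent to \<open>s \<le> a * l\<close>, which is exactly what puts the index
    \<open>a * l + 2 * a + s\<close> below the order \<open>2 * a * l + 2 * a + 1\<close>.\<close>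
  have "s + a - 1 < a * Suc l"
    using l(2) a by (metis div_less_iff_less_mult le_imp_less_Suc mult.commute)
  then have "a * m + s < (a - 1) + (2 * (a * l + 1) + a)"
    using a l(1) by simp
  then show "fps_nth (fps_nth (cleared_num a F) m) (a * m + s) = 0"
    unfolding l(1) by (rule power_dvd_imp_fps_nth_eq_0[OF power_dvd_cleared_num_nth])
qed

end

text \<open>
  Comparing coefficients of \<open>q\<^sup>r\<close> in \<open>d * g = n\<close> expresses \<open>d\<^sub>0 g\<^sub>r\<close> through \<open>n\<^sub>r\<close> and the
  \<open>d\<^sub>a\<^sub>k g\<^sub>r\<^sub>-\<^sub>a\<^sub>k\<close> with \<open>1 \<le> k \<le> r/a\<close>.
\<close>

lemma fps_degree_le_quotient_nth:
  fixes d g n :: "'a::comm_ring_1 fps fps"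
  assumes dg: "d * g = n" and a: "a > 0"
    and d0: "\<And>t. \<not> a dvd t \<Longrightarrow> fps_nth d t = 0"
    and d: "\<And>k. fps_degree_le (k + 1) (fps_nth d (a * k))"
    and n: "\<And>s. fps_degree_le ((s + a - 1) div a + 1) (fps_nth n s)"
  shows "fps_degree_le (r div a + (r + a - 1) div a + 1) (fps_nth g r * fps_nth d 0 ^ Suc (r div a))"
proof (induction r rule: less_induct)
  case (less r)
  define q where "q = r div a"
  define L where "L = fps_nth d 0"
  define B where "B = q + (r + a - 1) div a + 1"
  have L: "fps_degree_le 1 L"
    using d[of 0] by (simp add: L_def)
  have "fps_nth n r = L * fps_nth g r + (\<Sum>t=1..r. fps_nth d t * fps_nth g (r - t))"
    by (simp add: L_def fps_mult_nth sum.atLeast_Suc_atMost flip: dg)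
  then have "fps_nth g r * L ^ Suc q =
      fps_nth n r * L ^ q - (\<Sum>t=1..r. fps_nth d t * fps_nth g (r - t)) * L ^ q"
    by (simp add: algebra_simps)
  also have "\<dots> = fps_nth n r * L ^ q - (\<Sum>t=1..r. fps_nth d t * fps_nth g (r - t) * L ^ q)"
    by (simp add: sum_distrib_right)
  also have "fps_degree_le B \<dots>"
  proof (intro fps_degree_le_diff fps_degree_le_sum)
    show "fps_degree_le B (fps_nth n r * L ^ q)"
      using fps_degree_le_mult[OF n[of r] fps_degree_le_power[OF L, of q]]
      by (simp add: B_def add_ac)
    fix t assume t: "t \<in> {1..r}"
    show "fps_degree_le B (fps_nth d t * fps_nth g (r - t) * L ^ q)"
    proof (cases "a dvd t")
      case True
      then obtain k where k: "t = a * k" ..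
      have k1: "k \<ge> 1" and kr: "a * k \<le> r"
        using t k by (auto simp: Suc_le_eq)
      have kq: "k \<le> q"
        using kr a by (simp add: q_def less_eq_div_iff_mult_less_eq mult.commute)
      have "r div a = (r - t + k * a) div a"
        using kr k by (simp add: mult.commute)
      also have "\<dots> = k + (r - t) div a"
        using a by (subst div_mult_self1) auto
      finally have div1: "(r - t) div a = q - k"
        by (simp add: q_def)
      have "(r + a - 1) div a = (r - t + a - 1 + k * a) div a"
        using kr k a by (simp add: mult.commute)
      also have "\<dots> = k + (r - t + a - 1) div a"
        using a by (subst div_mult_self1) auto
      finally have div2: "(r + a - 1) div a = k + (r - t + a - 1) div a" .
      have "r - t < r"
        using t by auto
      from less[OF this]
      have IH: "fps_degree_le (q - k + (r - t + a - 1) div a + 1) (fps_nth g (r - t) * L ^ Suc (q - k))"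
        by (simp only: div1 L_def)
      \<comment> \<open>The induction hypothesis uses \<open>q - k + 1\<close> of the
        \<open>q\<close> factors \<open>L\<close>, leaving \<open>k - 1\<close>. Both quotients drop
        by \<open>k\<close> from \<open>r\<close> to \<open>r - t\<close>, which balances the extra
        degree \<open>2k\<close>.\<close>
      have "fps_degree_le ((k + 1) + (k - 1) + (q - k + (r - t + a - 1) div a + 1))
          (fps_nth d t * L ^ (k - 1) * (fps_nth g (r - t) * L ^ Suc (q - k)))"
        unfolding k by (intro fps_degree_le_mult[OF fps_degree_le_mult[OF d]]
            fps_degree_le_power L IH[unfolded k])
      also have "fps_nth d t * L ^ (k - 1) * (fps_nth g (r - t) * L ^ Suc (q - k)) =
          fps_nth d t * fps_nth g (r - t) * L ^ ((k - 1) + Suc (q - k))"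
        by (simp only: power_add mult_ac)
      also have "(k - 1) + Suc (q - k) = q"
        using k1 kq by simp
      also have "(k + 1) + (k - 1) + (q - k + (r - t + a - 1) div a + 1) = B"
        using k1 kq div2 by (simp add: B_def)
      finally show ?thesis .
    qed (simp add: d0)
  qed
  finally show ?case
    by (simp only: q_def L_def B_def)
qed

subsection \<open>Coefficients of rational functions with a single pole\<close>

text \<open>The witness is \<open>(m+1)...(m+n) / n!\<close>; these binomials are the coefficients
  of \<open>(1 - x)^-(n+1)\<close>.\<close>

lemma binomial_as_poly:
  obtains P :: "'a::field_char_0 poly"
  where "degree P \<le> n" "\<And>m. of_nat (m + n choose n) = poly P (of_nat m)"
proof
  let ?P = "smult (1 / fact n) (\<Prod>i=1..n. [:of_nat i, 1:]) :: 'a poly"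
  have "degree (\<Prod>i=1..n. [:of_nat i, 1:] :: 'a poly) \<le> n"
    by (rule order_trans[OF degree_prod_sum_le]) (auto simp: o_def)
  then show "degree ?P \<le> n"
    using degree_smult_le order_trans by blast
  fix m
  have "poly ?P (of_nat m) = pochhammer (of_nat m + 1) n / fact n"
    by (simp add: poly_prod pochhammer_prod prod.atLeast1_atMost_eq atLeast0LessThan lessThan_Suc_atMost add_ac)
  also have "\<dots> = of_nat (m + n) gchoose n"
    by (simp add: gbinomial_pochhammer' add_ac)
  also have "\<dots> = of_nat (m + n choose n)"
    by (rule binomial_gbinomial[symmetric])
  finally show "of_nat (m + n choose n) = poly ?P (of_nat m)" ..
qed

lemma degree_div_le:
  fixes p d :: "'a::field poly"
  shows "degree (p div d) \<le> degree p - degree d"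
proof (cases "d = 0 \<or> p div d = 0")
  case False
  then have "degree (p div d * d) = degree (p div d) + degree d"
    by (simp add: degree_mult_eq)
  moreover have "p div d * d = p - p mod d"
    by (simp add: minus_mod_eq_div_mult)
  moreover have "degree (p - p mod d) \<le> degree p"
    using False degree_mod_less[of d p]
    by (intro degree_diff_le) (auto simp: div_poly_less not_le intro: ccontr dest: less_imp_le)
  ultimately show ?thesis by simp
qed auto

text \<open>Partial fractions: dividing \<open>A\<close> by the linear \<open>l\<close> leaves a
  constant \<open>b\<close>, and \<open>b / l^(k+1)\<close> has coefficients \<open>b * c^m\<close>
  times a binomial. Induction treats the quotient over the next lower power.\<close>

lemma proper_fraction_nth:
  fixes c :: "'a::field_char_0"
  assumes "c \<noteq> 0" "degree A \<le> n"
  obtains P where "degree P \<le> n"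
    "\<And>m. fps_nth (fps_of_poly A / fps_of_poly [:1, - c:] ^ Suc n) m = c ^ m * poly P (of_nat m)"
proof -
  define l where "l = [:1, - c:]"
  have l: "fps_of_poly l = 1 - fps_const c * fps_X" "degree l = 1"
    using assms(1) by (simp_all add: l_def fps_of_poly_pCons)
  have unit: "fps_nth (fps_of_poly l ^ k) 0 \<noteq> 0" for k
    by (simp add: l)
  have const: "\<exists>P. degree P \<le> k \<and>
      (\<forall>m. fps_nth (fps_const b / fps_of_poly l ^ Suc k) m = c ^ m * poly P (of_nat m))" for b k
  proof -
    obtain P :: "'a poly" where P: "degree P \<le> k" "\<And>m. of_nat (m + k choose k) = poly P (of_nat m)"
      using binomial_as_poly[of k] by blast
    have "fps_nth (fps_const b / fps_of_poly l ^ Suc k) m = c ^ m * poly (smult b P) (of_nat m)" for m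
    proof -
      have "fps_const b / fps_of_poly l ^ Suc k = fps_const b * inverse (fps_of_poly l ^ Suc k)"
        using unit by (rule fps_divide_unit)
      also have "inverse (fps_of_poly l ^ Suc k) = Abs_fps (\<lambda>m. of_nat (m + k choose m) * c ^ m)"
        unfolding l by (subst one_minus_const_fps_X_neg_power') (simp_all add: add.commute)
      finally show ?thesis
        using P(2)[of m] binomial_symmetric[of m "m + k"] by (simp add: mult_ac)
    qed
    then show ?thesis
      using P(1) degree_smult_le order_trans by blast
  qed
  have "\<exists>P. degree P \<le> n \<and>
      (\<forall>m. fps_nth (fps_of_poly A / fps_of_poly l ^ Suc n) m = c ^ m * poly P (of_nat m))"
    using assms(2)
  proof (induction n arbitrary: A)
    case 0
    then obtain b where "A = [:b:]"
      by (metis degree_eq_zeroE le_zero_eq)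
    then show ?case
      using const[of 0 b] by (simp add: fps_of_poly_const)
  next
    case (Suc n)
    have "A mod l = 0 \<or> degree (A mod l) < degree l"
      using l(2) by (intro degree_mod_less) auto
    then have "degree (A mod l) = 0"
      by (auto simp: l(2))
    then obtain b where b: "A mod l = [:b:]"
      by (metis degree_eq_zeroE)
    have "degree (A div l) \<le> n"
      using degree_div_le[of A l] Suc.prems l(2) by simp
    then obtain P where P: "degree P \<le> n"
      "\<And>m. fps_nth (fps_of_poly (A div l) / fps_of_poly l ^ Suc n) m = c ^ m * poly P (of_nat m)"
      using Suc.IH by blast
    obtain P' where P': "degree P' \<le> Suc n"
      "\<And>m. fps_nth (fps_const b / fps_of_poly l ^ Suc (Suc n)) m = c ^ m * poly P' (of_nat m)"
      using const by blast
    have "fps_of_poly A = fps_of_poly (A div l * l + A mod l)"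
      by (simp only: div_mult_mod_eq)
    also have "\<dots> = fps_of_poly (A div l) * fps_of_poly l + fps_const b"
      unfolding b fps_of_poly_add fps_of_poly_mult by simp
    finally have "fps_of_poly A / fps_of_poly l ^ Suc (Suc n) =
        fps_of_poly (A div l) * fps_of_poly l / (fps_of_poly l ^ Suc n * fps_of_poly l)
        + fps_const b / fps_of_poly l ^ Suc (Suc n)"
      by (simp only: fps_divide_add power_Suc2)
    also have "fps_of_poly (A div l) * fps_of_poly l / (fps_of_poly l ^ Suc n * fps_of_poly l) =
        fps_of_poly (A div l) / fps_of_poly l ^ Suc n"
      using unit[of 1] by (intro div_mult_mult2) auto
    finally have "\<forall>m. fps_nth (fps_of_poly A / fps_of_poly l ^ Suc (Suc n)) m =
        c ^ m * poly (P + P') (of_nat m)"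
      by (simp only: fps_add_nth P(2) P'(2) poly_add distrib_left simp_thms)
    moreover have "degree (P + P') \<le> Suc n"
      using P(1) P'(1) by (intro degree_add_le) auto
    ultimately show ?case by blast
  qed
  then show ?thesis
    using that unfolding l_def by blast
qed

text \<open>Beyond the degree of the polynomial part, only the proper fraction contributes to the
  coefficients.\<close>

lemma rational_fps_nth:
  fixes c :: "'a::field_char_0" and H :: "'a poly"
  assumes "c \<noteq> 0"
  defines "L \<equiv> [:1, - c:]"
  obtains P where "degree P \<le> n"
    "\<And>m. m > degree (H div L ^ Suc n) \<Longrightarrow>
       fps_nth (fps_of_poly H / fps_of_poly L ^ Suc n) m = c ^ m * poly P (of_nat m)"
proof -
  have L: "L \<noteq> 0" "degree (L ^ Suc n) = Suc n" "fps_nth (fps_of_poly L ^ Suc n) 0 \<noteq> 0"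
    using assms(1) by (simp_all add: L_def degree_power_eq del: power_Suc)
  have deg: "degree (H mod L ^ Suc n) \<le> n"
    using degree_mod_less[of "L ^ Suc n" H] L by (auto simp del: power_Suc)
  obtain P where P: "degree P \<le> n"
    "\<And>m. fps_nth (fps_of_poly (H mod L ^ Suc n) / fps_of_poly L ^ Suc n) m = c ^ m * poly P (of_nat m)"
    using proper_fraction_nth[OF assms(1) deg, folded L_def] by blast
  have "fps_of_poly H = fps_of_poly (H div L ^ Suc n * L ^ Suc n + H mod L ^ Suc n)"
    by (simp only: div_mult_mod_eq)
  then have "fps_of_poly H / fps_of_poly L ^ Suc n =
      fps_of_poly (H div L ^ Suc n) * fps_of_poly L ^ Suc n / fps_of_poly L ^ Suc n
      + fps_of_poly (H mod L ^ Suc n) / fps_of_poly L ^ Suc n"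
    by (simp only: fps_of_poly_add fps_of_poly_mult fps_of_poly_power fps_divide_add)
  also have "fps_of_poly (H div L ^ Suc n) * fps_of_poly L ^ Suc n / fps_of_poly L ^ Suc n
      = fps_of_poly (H div L ^ Suc n)"
    using L(3) by (intro nonzero_mult_div_cancel_right) auto
  finally have "fps_nth (fps_of_poly H / fps_of_poly L ^ Suc n) m = c ^ m * poly P (of_nat m)"
    if "m > degree (H div L ^ Suc n)" for m
    using that by (simp only: fps_add_nth P(2) fps_of_poly_nth coeff_eq_0 add_0)
  with P(1) that show ?thesis by blast
qed

section \<open>Rounding and assembly of the bounds\<close>

lemma ceiling_divide_nat:
  assumes "a > 0"
  shows "\<lfloor>(real r - 1) / real a\<rfloor> + 1 = int ((r + a - 1) div a)"
    and "\<lceil>real r / real a\<rceil> = int ((r + a - 1) div a)"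
proof -
  have "(real r - 1) / real a + 1 = real (r + a - 1) / real a"
    using assms by (simp add: field_simps of_nat_diff)
  then have "\<lfloor>(real r - 1) / real a + 1\<rfloor> = int ((r + a - 1) div a)"
    by (simp only: floor_divide_of_nat_eq)
  then show "\<lfloor>(real r - 1) / real a\<rfloor> + 1 = int ((r + a - 1) div a)"
    by simp
  define b where "b = (r + a - 1) div a"
  have "a * b + (r + a - 1) mod a = r + a - 1" "(r + a - 1) mod a < a"
    using assms by (simp_all add: b_def)
  then have "a * b < r + a" "r \<le> a * b"
    using assms by linarith+
  then have "real a * real b < real r + real a" "real r \<le> real a * real b"
    by (simp_all flip: of_nat_mult of_nat_add)
  then have "\<lceil>real r / real a\<rceil> = int b"
    using assms by (intro ceiling_unique) (simp_all add: field_simps)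
  then show "\<lceil>real r / real a\<rceil> = int ((r + a - 1) div a)"
    by (simp only: b_def)
qed

theorem theorem2p8:
  fixes F :: "'a::field_char_0 fps" and a r :: nat
  assumes "a \<ge> 2" and "fps_nth F 0 = 1"
  shows "\<exists>H :: 'a poly.
      diag_gf a F r =
        fps_of_poly H / fps_of_poly (L_poly F) ^ nat (1 + \<lfloor>real r / real a\<rfloor>) \<and>
      int (degree H) \<le> \<lfloor>real r / real a\<rfloor> + \<lfloor>(real r - 1) / real a\<rfloor> + 2 \<and>
      (1 + fps_nth F 1 \<noteq> 0 \<longrightarrow>
        int (degree (H div L_poly F ^ nat (1 + \<lfloor>real r / real a\<rfloor>))) \<le> \<lceil>real r / real a\<rceil> \<and>
        (\<exists>P :: 'a poly. int (degree P) \<le> \<lfloor>real r / real a\<rfloor> \<and>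
          (\<forall>m :: nat. int m \<ge> \<lceil>real r / real a\<rceil> + 1 \<longrightarrow>
            fps_nth (diag_gf a F r) m = (1 + fps_nth F 1) ^ m * poly P (of_nat m))))"
proof -
  have a: "a > 0" using assms(1) by simp
  define q where "q = r div a"
  define b where "b = (r + a - 1) div a"
  have floor: "\<lfloor>real r / real a\<rfloor> = int q" "nat (1 + int q) = Suc q"
    by (simp_all add: q_def floor_divide_of_nat_eq)
  \<comment> \<open>With \<open>b\<close> the ceiling, the required bound
    \<open>q + (b - 1) + 2\<close> is \<open>q + b + 1\<close>; for \<open>r = 0\<close> this uses
    the floor -1 of \<open>-1/a\<close>.\<close>
  have ceil: "\<lceil>real r / real a\<rceil> = int b" "\<lfloor>(real r - 1) / real a\<rfloor> = int b - 1"
    using ceiling_divide_nat[OF a, of r] by (simp_all add: b_def)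
  have "fps_degree_le (r div a + (r + a - 1) div a + 1) (fps_nth (Abs_fps (diag_gf a F)) r
      * fps_nth (diagonals a (cleared_den a F)) 0 ^ Suc (r div a))"
    by (intro fps_degree_le_quotient_nth[OF diagonals_cleared_mult_diag_gf[OF a assms(2)] a]
        diagonals_cleared_den_eq_0[OF a assms(2)] fps_degree_le_diagonals_cleared_den[OF a assms(2)]
        fps_degree_le_diagonals_cleared_num[OF a assms(2)])
  then have "fps_degree_le (q + b + 1) (diag_gf a F r * fps_of_poly (L_poly F) ^ Suc q)"
    by (simp only: diagonals_cleared_den_0[OF a assms(2)] fps_nth_Abs_fps q_def b_def)
  then obtain H where H: "diag_gf a F r * fps_of_poly (L_poly F) ^ Suc q = fps_of_poly H"
    "degree H \<le> q + b + 1"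
    by (rule fps_degree_le_imp_poly)
  have "fps_of_poly (L_poly F) \<noteq> 0"
    by (simp add: L_poly_def)
  then have g: "diag_gf a F r = fps_of_poly H / fps_of_poly (L_poly F) ^ Suc q"
    unfolding H(1)[symmetric] by (intro nonzero_mult_div_cancel_right[symmetric] power_not_zero)
  have "degree (H div L_poly F ^ Suc q) \<le> b \<and>
      (\<exists>P. degree P \<le> q \<and> (\<forall>m>b. fps_nth (diag_gf a F r) m = (1 + fps_nth F 1) ^ m * poly P (of_nat m)))"
    if c: "1 + fps_nth F 1 \<noteq> 0"
  proof -
    have "degree ([:1, - x:] ^ Suc q) = Suc q" if "x \<noteq> 0" for x :: 'a
      using that by (simp add: degree_power_eq del: power_Suc)
    \<comment> \<open>As \<open>L\<close> is now truly linear, division by \<open>L^(q+1)\<close>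
      lowers the bound \<open>q + b + 1\<close> to \<open>b\<close>.\<close>
    from this[OF c] have deg: "degree (H div L_poly F ^ Suc q) \<le> b"
      using degree_div_le[of H "L_poly F ^ Suc q"] H(2)
      unfolding L_poly_def by linarith
    obtain P where "degree P \<le> q" "\<And>m. m > degree (H div L_poly F ^ Suc q) \<Longrightarrow>
        fps_nth (diag_gf a F r) m = (1 + fps_nth F 1) ^ m * poly P (of_nat m)"
      unfolding g L_poly_def using c by (rule rational_fps_nth) blast
    with deg show ?thesis
      by (metis le_less_trans)
  qed
  moreover have "int m \<ge> int b + 1 \<longleftrightarrow> m > b" for m
    by linarith
  ultimately show ?thesis
    unfolding floor ceil using g H(2) by (intro exI[of _ H]) (simp del: power_Suc)
qed

end
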